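(* Let $\mathcal P$ be a special poset. Then $\text{sat}^*(n,\mathcal P)=O(n)$.
   Context: A finite poset $\mathcal P$ is special if it consists of a poset $\mathcal P'$ having both a unique minimal and a unique maximal element, together with one additional element that is incomparable to every element of $\mathcal P'$. A poset $\mathcal Q$ contains an induced copy of a poset $\mathcal P$ if there is an injective map $f:\mathcal P\to\mathcal Q$ with $f(x)\le f(y)$ iff $x\le y$. A family $\mathcal F$ of subsets of $[n]$ (ordered by inclusion) is $\mathcal P$-saturated if $\mathcal F$ contains no induced copy of $\mathcal P$ but for every $S\subseteq[n]$ with $S\notin\mathcal F$, $\mathcal F\cup\{S\}$ contains an induced copy of $\mathcal P$; $\text{sat}^*(n,\mathcal P)$ is the minimum size of a $\mathcal P$-saturated family of subsets of $[n]$. *)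

theory Defs
  imports Complex_Main "HOL-Library.Landau_Symbols"
begin

text \<open>A poset is a carrier \<open>P\<close> together with a reflexive order relation \<open>r\<close> on it, i.e.
  \<open>partial_order_on P r\<close>; the pair \<open>(x, y) \<in> r\<close> means \<open>x \<le> y\<close>.\<close>

definition minimal_elem :: "'a set \<Rightarrow> 'a rel \<Rightarrow> 'a \<Rightarrow> bool" where
  "minimal_elem Q r m \<longleftrightarrow> m \<in> Q \<and> (\<forall>y\<in>Q. (y, m) \<in> r \<longrightarrow> y = m)"

definition maximal_elem :: "'a set \<Rightarrow> 'a rel \<Rightarrow> 'a \<Rightarrow> bool" where
  "maximal_elem Q r m \<longleftrightarrow> m \<in> Q \<and> (\<forall>y\<in>Q. (m, y) \<in> r \<longrightarrow> y = m)"

definition special_poset :: "'a set \<Rightarrow> 'a rel \<Rightarrow> bool" where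
  "special_poset P r \<longleftrightarrow>
     finite P \<and> partial_order_on P r \<and>
     (\<exists>P' x. P = insert x P' \<and> x \<notin> P' \<and>
        (\<exists>!m. minimal_elem P' r m) \<and> (\<exists>!m. maximal_elem P' r m) \<and>
        (\<forall>y\<in>P'. (x, y) \<notin> r \<and> (y, x) \<notin> r))"

definition contains_induced_copy :: "'b set \<Rightarrow> 'b rel \<Rightarrow> 'a set \<Rightarrow> 'a rel \<Rightarrow> bool" where
  "contains_induced_copy Q s P r \<longleftrightarrow>
     (\<exists>f. f ` P \<subseteq> Q \<and> inj_on f P \<and> (\<forall>x\<in>P. \<forall>y\<in>P. (f x, f y) \<in> s \<longleftrightarrow> (x, y) \<in> r))"

definition family_contains :: "'b set set \<Rightarrow> 'a set \<Rightarrow> 'a rel \<Rightarrow> bool" where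
  "family_contains F P r \<longleftrightarrow> contains_induced_copy F (relation_of (\<subseteq>) F) P r"

definition saturated :: "nat \<Rightarrow> 'a set \<Rightarrow> 'a rel \<Rightarrow> nat set set \<Rightarrow> bool" where
  "saturated n P r F \<longleftrightarrow>
     F \<subseteq> Pow {1..n} \<and> \<not> family_contains F P r \<and>
     (\<forall>S. S \<subseteq> {1..n} \<and> S \<notin> F \<longrightarrow> family_contains (F \<union> {S}) P r)"

text \<open>The minimum below is attained for every nonempty poset, by lemma \<open>saturated_exists\<close>.\<close>

definition sat_star :: "nat \<Rightarrow> 'a set \<Rightarrow> 'a rel \<Rightarrow> nat" where
  "sat_star n P r = (LEAST k. \<exists>F. saturated n P r F \<and> card F = k)"

lemma saturated_exists:
  assumes "P \<noteq> {}"
  shows "\<exists>F. saturated n P r F"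
proof -
  define A where "A = {F. F \<subseteq> Pow {1..n} \<and> \<not> family_contains F P r}"
  have "finite A" unfolding A_def
    by (rule finite_subset[of _ "Pow (Pow {1..n})"]) auto
  moreover have "{} \<in> A"
    using assms by (simp add: A_def family_contains_def contains_induced_copy_def)
  then have "A \<noteq> {}" by blast
  ultimately obtain F where F: "F \<in> A" and mx: "\<forall>G\<in>A. F \<subseteq> G \<longrightarrow> F = G"
    using finite_has_maximal[of A] by blast
  have "family_contains (F \<union> {S}) P r" if "S \<subseteq> {1..n}" "S \<notin> F" for S
  proof (rule ccontr)
    assume "\<not> family_contains (F \<union> {S}) P r"
    hence "F \<union> {S} \<in> A" using F that(1) by (simp add: A_def)
    with mx have "F = F \<union> {S}" by blast
    with that(2) show False by blast
  qed
  then have "saturated n P r F" using F unfolding saturated_def A_def by simp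
  then show ?thesis ..
qed

lemma sat_star_attained:
  assumes "special_poset P r"
  shows "\<exists>F. saturated n P r F \<and> card F = sat_star n P r"
proof -
  have "P \<noteq> {}" using assms unfolding special_poset_def by blast
  then obtain F where "saturated n P r F" using saturated_exists by metis
  then have "\<exists>F'. saturated n P r F' \<and> card F' = card F" by blast
  then show ?thesis unfolding sat_star_def
    by (rule LeastI[where P = "\<lambda>k. \<exists>F. saturated n P r F \<and> card F = k"])
qed

end

theory Submission
  imports Defs
begin

text \<open>Write \<open>P = insert x Q\<close> with \<open>x\<close> the isolated element, and let \<open>m = card Q\<close>. Place one copy of
  \<open>Q\<close> in each interval from \<open>{1..t * m}\<close> to \<open>{1..(t + 1) * m}\<close> of the Boolean lattice. Sets from
  different intervals are comparable, whereas \<open>x\<close> is incomparable to all of \<open>Q\<close>; so a copy of \<open>P\<close>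
  in the resulting family would have to fit into a single interval, which only holds \<open>m\<close> sets.
  Extend this family to a saturated one. If \<open>S\<close> belongs to it, misses \<open>i + 1\<close> and contains some
  \<open>s > i + 2 * m\<close>, then \<open>S\<close> is incomparable to every set lying between \<open>{1..i + 1}\<close> and
  \<open>{1..s - 1}\<close>, hence to a whole copy of \<open>Q\<close>, a contradiction. Thus every \<open>S\<close> satisfies
  \<open>{1..i} \<subseteq> S \<subseteq> {1..i + 2 * m}\<close> for some \<open>i \<le> n\<close>, which leaves \<open>(n + 1) * 4 ^ m\<close> sets at most.\<close>

lemma family_contains_iff:
  "family_contains F P r \<longleftrightarrow>
     (\<exists>f. f ` P \<subseteq> F \<and> inj_on f P \<and> (\<forall>x\<in>P. \<forall>y\<in>P. f x \<subseteq> f y \<longleftrightarrow> (x, y) \<in> r))"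
  unfolding family_contains_def contains_induced_copy_def relation_of_def
  by (intro iff_exI conj_cong ball_cong refl) auto

text \<open>Only finitely many copy-free families lie between \<open>G\<close> and
  \<open>Pow {1..n}\<close>, and a maximal one is saturated. A seed \<open>G\<close> can thus be
  chosen freely to constrain the sets of some saturated family.\<close>

lemma saturated_extension:
  assumes "G \<subseteq> Pow {1..n}" and "\<not> family_contains G P r"
  obtains F where "saturated n P r F" and "G \<subseteq> F"
proof -
  define A where "A = {F. G \<subseteq> F \<and> F \<subseteq> Pow {1..n} \<and> \<not> family_contains F P r}"
  have "finite A" unfolding A_def
    by (rule finite_subset[of _ "Pow (Pow {1..n})"]) auto
  moreover have "A \<noteq> {}" using assms by (auto simp: A_def)
  ultimately obtain F where F: "F \<in> A" and mx: "\<forall>H\<in>A. F \<subseteq> H \<longrightarrow> F = H"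
    using finite_has_maximal[of A] by blast
  have "family_contains (F \<union> {S}) P r" if "S \<subseteq> {1..n}" "S \<notin> F" for S
  proof (rule ccontr)
    assume "\<not> family_contains (F \<union> {S}) P r"
    hence "F \<union> {S} \<in> A" using F that(1) by (auto simp: A_def)
    with mx that(2) show False by blast
  qed
  then have "saturated n P r F" using F by (simp add: saturated_def A_def)
  moreover have "G \<subseteq> F" using F by (simp add: A_def)
  ultimately show thesis by (rule that)
qed

text \<open>The image of \<open>x\<close> lies in some block \<open>B t\<close>. Images of
  \<open>Q\<close> are incomparable to it, so they cannot lie in any other block, and
  \<open>B t\<close> is too small for the whole copy.\<close>

lemma not_family_contains_isolated_Union:
  assumes isolated: "\<forall>y\<in>Q. (x, y) \<notin> r \<and> (y, x) \<notin> r"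
    and comparable: "\<And>t u X Y. t \<in> T \<Longrightarrow> u \<in> T \<Longrightarrow> t \<noteq> u \<Longrightarrow> X \<in> B t \<Longrightarrow> Y \<in> B u \<Longrightarrow> X \<subseteq> Y \<or> Y \<subseteq> X"
    and small: "\<And>t. t \<in> T \<Longrightarrow> finite (B t) \<and> card (B t) < card (insert x Q)"
  shows "\<not> family_contains (\<Union>t\<in>T. B t) (insert x Q) r"
proof
  assume "family_contains (\<Union>t\<in>T. B t) (insert x Q) r"
  then obtain f where f: "f ` insert x Q \<subseteq> (\<Union>t\<in>T. B t)" "inj_on f (insert x Q)"
    and ord: "\<forall>u\<in>insert x Q. \<forall>v\<in>insert x Q. f u \<subseteq> f v \<longleftrightarrow> (u, v) \<in> r"
    unfolding family_contains_iff by blast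
  from f(1) obtain t where t: "t \<in> T" "f x \<in> B t" by auto
  have "f y \<in> B t" if "y \<in> Q" for y
  proof -
    have "f y \<in> (\<Union>t\<in>T. B t)" using f(1) that by (simp add: image_subset_iff)
    then obtain u where u: "u \<in> T" "f y \<in> B u" by (rule UN_E)
    have "\<not> (f x \<subseteq> f y \<or> f y \<subseteq> f x)" using ord isolated that by simp
    then have "u = t" using comparable[OF t(1) u(1) _ t(2) u(2)] by metis
    then show ?thesis using u by simp
  qed
  then have "f ` insert x Q \<subseteq> B t" using t by blast
  then have "card (insert x Q) \<le> card (B t)"
    using card_inj_on_le[OF f(2)] small[OF t(1)] by simp
  then show False using small[OF t(1)] by simp
qed

text \<open>Sending \<open>x\<close> to \<open>S\<close> extends the embedding \<open>e\<close> of
  \<open>Q\<close>. The extended map preserves and reflects order, so it is injective by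
  antisymmetry.\<close>

lemma family_contains_insert_isolated:
  assumes refl: "(x, x) \<in> r" and antisym: "antisym r"
    and isolated: "\<forall>y\<in>Q. (x, y) \<notin> r \<and> (y, x) \<notin> r"
    and embed: "\<And>y z. y \<in> Q \<Longrightarrow> z \<in> Q \<Longrightarrow> e y \<subseteq> e z \<longleftrightarrow> (y, z) \<in> r"
    and mem: "e ` Q \<subseteq> F" "S \<in> F"
    and incomparable: "\<And>y. y \<in> Q \<Longrightarrow> \<not> S \<subseteq> e y \<and> \<not> e y \<subseteq> S"
  shows "family_contains F (insert x Q) r"
proof -
  define f where "f = e(x := S)"
  have "x \<notin> Q" using refl isolated by blast
  then have f: "f x = S" "\<And>y. y \<in> Q \<Longrightarrow> f y = e y" by (auto simp: f_def)
  have ord: "\<forall>u\<in>insert x Q. \<forall>v\<in>insert x Q. f u \<subseteq> f v \<longleftrightarrow> (u, v) \<in> r"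
    using f refl isolated embed incomparable by auto
  have "inj_on f (insert x Q)"
  proof (rule inj_onI)
    fix u v assume "u \<in> insert x Q" "v \<in> insert x Q" "f u = f v"
    then have "(u, v) \<in> r" "(v, u) \<in> r" using ord by blast+
    then show "u = v" using antisym by (meson antisymD)
  qed
  moreover have "f ` insert x Q \<subseteq> F" using f mem by auto
  ultimately show ?thesis unfolding family_contains_iff using ord by blast
qed

text \<open>This is the embedding of a poset by its principal down-sets, with \<open>Q\<close>
  numbered by \<open>g\<close>, shifted by \<open>t * card Q\<close> and stacked on an initial
  segment.\<close>

lemma poset_copies_in_consecutive_intervals:
  fixes Q :: "'a set" and r :: "'a rel"
  assumes "finite Q" "trans r" "\<forall>y\<in>Q. (y, y) \<in> r"
  obtains e :: "nat \<Rightarrow> 'a \<Rightarrow> nat set" where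
    "\<And>t y. y \<in> Q \<Longrightarrow> {1..t * card Q} \<subseteq> e t y \<and> e t y \<subseteq> {1..Suc t * card Q}"
    "\<And>t y z. y \<in> Q \<Longrightarrow> z \<in> Q \<Longrightarrow> e t y \<subseteq> e t z \<longleftrightarrow> (y, z) \<in> r"
proof -
  obtain g where g: "bij_betw g Q {1..card Q}"
    using assms(1) by (metis ex_bij_betw_nat_finite_1 bij_betw_inv)
  then have range: "\<And>y. y \<in> Q \<Longrightarrow> 1 \<le> g y \<and> g y \<le> card Q"
    by (metis atLeastAtMost_iff bij_betw_apply)
  have inj: "inj_on g Q" using g by (rule bij_betw_imp_inj_on)
  define e where "e = (\<lambda>t y. {1..t * card Q} \<union> (\<lambda>z. t * card Q + g z) ` {z\<in>Q. (z, y) \<in> r})"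
  show thesis
  proof (rule that[of e])
    fix t y assume "y \<in> Q"
    then show "{1..t * card Q} \<subseteq> e t y \<and> e t y \<subseteq> {1..Suc t * card Q}"
      unfolding e_def using range by fastforce
  next
    fix t y z assume yz: "y \<in> Q" "z \<in> Q"
    show "e t y \<subseteq> e t z \<longleftrightarrow> (y, z) \<in> r"
    proof
      assume "e t y \<subseteq> e t z"
      \<comment> \<open>By reflexivity \<open>y\<close> lies in its own down-set, so its code tests
        whether \<open>y\<close> is below \<open>z\<close>.\<close>
      moreover have "t * card Q + g y \<in> e t y" unfolding e_def using yz assms(3) by blast
      ultimately have "t * card Q + g y \<in> e t z" by blast
      \<comment> \<open>Numbering from 1 matters: \<open>g y\<close> is positive, so the code lies
        beyond \<open>{1..t * card Q}\<close> and must come from the down-set of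
        \<open>z\<close>.\<close>
      then have "\<exists>w\<in>Q. (w, z) \<in> r \<and> g y = g w"
        unfolding e_def using range[OF yz(1)] by auto
      then show "(y, z) \<in> r" using inj yz(1) by (metis inj_onD)
    next
      assume "(y, z) \<in> r"
      then show "e t y \<subseteq> e t z" unfolding e_def using assms(2) by (auto dest: transD)
    qed
  qed
qed

text \<open>A set in window \<open>i\<close> is determined by its trace on the \<open>k\<close>
  points after \<open>i\<close>.\<close>

lemma card_Union_interval_windows_le:
  "card (\<Union>i\<le>n. {S. {1..i} \<subseteq> S \<and> S \<subseteq> {1..i + k}}) \<le> (n + 1) * 2 ^ k"
proof -
  have "card {S. {1..i} \<subseteq> S \<and> S \<subseteq> {1..i + k}} \<le> 2 ^ k" for i :: nat
  proof -
    have "{S. {1..i} \<subseteq> S \<and> S \<subseteq> {1..i + k}} \<subseteq> (\<lambda>X. {1..i} \<union> X) ` Pow {i<..i + k}"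
    proof
      fix S assume "S \<in> {S. {1..i} \<subseteq> S \<and> S \<subseteq> {1..i + k}}"
      then have "S = {1..i} \<union> (S \<inter> {i<..i + k})" by fastforce
      then show "S \<in> (\<lambda>X. {1..i} \<union> X) ` Pow {i<..i + k}" by blast
    qed
    then have "card {S. {1..i} \<subseteq> S \<and> S \<subseteq> {1..i + k}} \<le> card (Pow {i<..i + k})"
      by (rule surj_card_le[rotated]) simp
    then show ?thesis by (simp add: card_Pow)
  qed
  then have "(\<Sum>i\<le>n. card {S. {1..i} \<subseteq> S \<and> S \<subseteq> {1..i + k}}) \<le> (\<Sum>i\<le>n. 2 ^ k)"
    by (intro sum_mono)
  then show ?thesis
    using card_UN_le[of "{..n}" "\<lambda>i. {S. {1..i} \<subseteq> S \<and> S \<subseteq> {1..i + k}}"] by simp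
qed

lemma sat_star_isolated_le:
  fixes Q :: "'a set" and r :: "'a rel"
  assumes fin: "finite Q" and ne: "Q \<noteq> {}" and po: "partial_order_on (insert x Q) r"
    and isolated: "\<forall>y\<in>Q. (x, y) \<notin> r \<and> (y, x) \<notin> r"
  shows "sat_star n (insert x Q) r \<le> (n + 1) * 2 ^ (2 * card Q)"
proof -
  define m where "m = card Q"
  have m: "m > 0" using fin ne by (simp add: m_def card_gt_0_iff)
  have r: "antisym r" "trans r" "\<forall>y\<in>insert x Q. (y, y) \<in> r"
    using po by (auto simp: partial_order_on_def preorder_on_def refl_on_def)
  then have x: "x \<notin> Q" using isolated by blast
  obtain e :: "nat \<Rightarrow> 'a \<Rightarrow> nat set" where
    e_between: "\<And>t y. y \<in> Q \<Longrightarrow> {1..t * m} \<subseteq> e t y \<and> e t y \<subseteq> {1..Suc t * m}" and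
    e_embed: "\<And>t y z. y \<in> Q \<Longrightarrow> z \<in> Q \<Longrightarrow> e t y \<subseteq> e t z \<longleftrightarrow> (y, z) \<in> r"
    unfolding m_def using poset_copies_in_consecutive_intervals[OF fin r(2)] r(3) by blast
  \<comment> \<open>These are the indices whose interval fits into \<open>{1..n}\<close>; for
    \<open>n < m\<close> there are none and \<open>G\<close> is empty.\<close>
  define T where "T = {t. Suc t * m \<le> n}"
  define G where "G = (\<Union>t\<in>T. e t ` Q)"
  have G_sub: "G \<subseteq> Pow {1..n}"
  proof -
    have "e t y \<subseteq> {1..n}" if "t \<in> T" "y \<in> Q" for t y
    proof -
      have "{1..Suc t * m} \<subseteq> {1..n}" using that(1) by (auto simp: T_def)
      then show ?thesis using e_between[OF that(2), of t] by blast
    qed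
    then show ?thesis by (auto simp: G_def)
  qed
  have below: "e t y \<subseteq> e u z" if "y \<in> Q" "z \<in> Q" "t < u" for t u y z
  proof -
    have "Suc t * m \<le> u * m" using that(3) by (intro mult_le_mono1) simp
    then have "{1..Suc t * m} \<subseteq> {1..u * m}" by auto
    then show ?thesis using e_between[OF that(1), of t] e_between[OF that(2), of u] by blast
  qed
  have G_free: "\<not> family_contains G (insert x Q) r"
    unfolding G_def
  proof (rule not_family_contains_isolated_Union[OF isolated])
    fix t u X Y assume "t \<noteq> u" "X \<in> e t ` Q" "Y \<in> e u ` Q"
    then show "X \<subseteq> Y \<or> Y \<subseteq> X" using below by (metis imageE linorder_neqE_nat)
  next
    fix t
    show "finite (e t ` Q) \<and> card (e t ` Q) < card (insert x Q)"
      using fin x card_image_le[OF fin, of "e t"] by simp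
  qed
  obtain F where F: "saturated n (insert x Q) r F" "G \<subseteq> F"
    using saturated_extension[OF G_sub G_free] by blast
  have "\<exists>i\<le>n. {1..i} \<subseteq> S \<and> S \<subseteq> {1..i + 2 * m}" if S: "S \<in> F" for S
  proof -
    have S_sub: "S \<subseteq> {1..n}" using F(1) S by (auto simp: saturated_def)
    \<comment> \<open>The longest initial segment inside \<open>S\<close>: 0 always qualifies, and
      the bound \<open>n\<close> ensures that a greatest value exists.\<close>
    define i where "i = (GREATEST i. i \<le> n \<and> {1..i} \<subseteq> S)"
    have i: "i \<le> n \<and> {1..i} \<subseteq> S"
      unfolding i_def by (rule GreatestI_nat[of _ 0 n]) auto
    have i_max: "j \<le> i" if "j \<le> n" "{1..j} \<subseteq> S" for j
      unfolding i_def using that by (intro Greatest_le_nat[of _ _ n]) auto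
    have "s \<le> i + 2 * m" if s: "s \<in> S" for s
    proof (rule ccontr)
      assume gap: "\<not> s \<le> i + 2 * m"
      have s_le: "s \<le> n" using s S_sub by auto
      \<comment> \<open>Maximality of \<open>i\<close> applies only to \<open>Suc i \<le> n\<close>,
        which follows from \<open>i + 2 * m < s \<le> n\<close>.\<close>
      have i1: "Suc i \<notin> S"
      proof
        assume "Suc i \<in> S"
        then have "{1..Suc i} \<subseteq> S" using i by (auto simp: le_Suc_eq)
        then show False using i_max[of "Suc i"] gap s_le by simp
      qed
      \<comment> \<open>\<open>t * m\<close> is the first multiple of \<open>m\<close> above
        \<open>i\<close>. Rounding up costs at most \<open>m\<close> and the interval itself another
        \<open>m\<close>, whence the window length \<open>2 * m\<close>. Each \<open>e t y\<close>
        then contains \<open>Suc i\<close> but not \<open>s\<close>, the opposite of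
        \<open>S\<close>.\<close>
      define t where "t = Suc (i div m)"
      have lower: "Suc i \<le> t * m"
        using m by (simp add: t_def) (metis Suc_leI dividend_less_div_times)
      have "Suc t * m = i div m * m + 2 * m" by (simp add: t_def)
      also have "\<dots> \<le> i + 2 * m" by simp
      finally have upper: "Suc t * m < s" using gap by linarith
      have "\<not> S \<subseteq> e t y \<and> \<not> e t y \<subseteq> S" if "y \<in> Q" for y
      proof -
        have "Suc i \<in> e t y" using e_between[OF that, of t] lower by auto
        moreover have "s \<notin> e t y" using e_between[OF that, of t] upper by auto
        ultimately show ?thesis using i1 s by blast
      qed
      moreover have "t \<in> T" using upper s_le by (simp add: T_def)
      then have "e t ` Q \<subseteq> F" using F(2) by (auto simp: G_def)
      ultimately have "family_contains F (insert x Q) r"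
        using r e_embed S isolated
        by (intro family_contains_insert_isolated[where e = "e t" and S = S]) auto
      then show False using F(1) by (simp add: saturated_def)
    qed
    then have "S \<subseteq> {1..i + 2 * m}" using S_sub by auto
    then show ?thesis using i by blast
  qed
  then have F_sub: "F \<subseteq> (\<Union>i\<le>n. {S. {1..i} \<subseteq> S \<and> S \<subseteq> {1..i + 2 * m}})" by blast
  have "finite {S. {1..i} \<subseteq> S \<and> S \<subseteq> {1..i + 2 * m}}" for i :: nat
    by (rule finite_subset[of _ "Pow {1..i + 2 * m}"]) auto
  then have "card F \<le> card (\<Union>i\<le>n. {S. {1..i} \<subseteq> S \<and> S \<subseteq> {1..i + 2 * m}})"
    by (intro card_mono F_sub) simp
  also have "\<dots> \<le> (n + 1) * 2 ^ (2 * m)" by (rule card_Union_interval_windows_le)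
  finally have "card F \<le> (n + 1) * 2 ^ (2 * m)" .
  moreover have "sat_star n (insert x Q) r \<le> card F"
    unfolding sat_star_def using F(1) by (intro Least_le) blast
  ultimately show ?thesis by (simp add: m_def)
qed

theorem theorem3p1:
  fixes P :: "'a set" and r :: "'a rel"
  assumes "special_poset P r"
  shows "(\<lambda>n. real (sat_star n P r)) \<in> O(\<lambda>n. real n)"
proof -
  obtain Q x where P: "P = insert x Q" and Q: "finite Q" "Q \<noteq> {}"
    and po: "partial_order_on (insert x Q) r"
    and isolated: "\<forall>y\<in>Q. (x, y) \<notin> r \<and> (y, x) \<notin> r"
  proof -
    have P: "finite P" "partial_order_on P r"
      and "\<exists>Q x. P = insert x Q \<and> x \<notin> Q \<and>
        (\<exists>!m. minimal_elem Q r m) \<and> (\<exists>!m. maximal_elem Q r m) \<and>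
        (\<forall>y\<in>Q. (x, y) \<notin> r \<and> (y, x) \<notin> r)"
      using assms by (simp_all only: special_poset_def)
    then obtain Q x where Q: "P = insert x Q" "\<exists>!m. minimal_elem Q r m"
      and isolated: "\<forall>y\<in>Q. (x, y) \<notin> r \<and> (y, x) \<notin> r"
      by (elim exE conjE) (rule that)
    \<comment> \<open>The minimal element witnesses that \<open>Q\<close> is nonempty, so that
      \<open>card Q\<close> is positive and can serve as the divisor when rounding.\<close>
    have "Q \<noteq> {}" using ex1_implies_ex[OF Q(2)] by (auto simp: minimal_elem_def)
    moreover have "finite Q" "partial_order_on (insert x Q) r" using P Q(1) by simp_all
    ultimately show thesis using that[OF Q(1)] isolated by simp
  qed
  show ?thesis
  \<comment> \<open>The leading factor 2 absorbs \<open>n + 1 \<le> 2 * n\<close>, which holds from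
    \<open>n = 1\<close> on.\<close>
  proof (rule bigoI[where c = "2 * 2 ^ (2 * card Q)"])
    show "\<forall>\<^sub>F n in sequentially.
        norm (real (sat_star n P r)) \<le> 2 * 2 ^ (2 * card Q) * norm (real n)"
      using eventually_ge_at_top[of "1::nat"]
    proof eventually_elim
      case (elim n)
      have "sat_star n P r \<le> (n + 1) * 2 ^ (2 * card Q)"
        unfolding P by (rule sat_star_isolated_le[OF Q po isolated])
      also have "\<dots> \<le> (2 * n) * 2 ^ (2 * card Q)" using elim by (intro mult_le_mono1) simp
      finally have "real (sat_star n P r) \<le> real ((2 * n) * 2 ^ (2 * card Q))"
        by (rule of_nat_mono)
      then show ?case by (simp add: mult_ac)
    qed
  qed
qed

end
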